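(* Let $$\mathbf A=\sum_{\nu=1}^{R}\xi_\nu\,\mathbf a^{(1)}_\nu\otimes\mathbf a^{(2)}_\nu\otimes\mathbf a^{(3)}_\nu\in\mathbb R^{n\times n\times n},\qquad \xi_\nu\in\mathbb R,$$ with normalized vectors $\mathbf a^{(\ell)}_\nu\in\mathbb R^n$, $\|\mathbf a^{(\ell)}_\nu\|=1$, satisfy the stability condition $$\sum_{\nu=1}^{R}\xi_\nu^2\le C\,\|\mathbf A\|^2$$ with a constant $C>0$. Then the RHOSVD approximation $\mathbf A^0_{(\mathbf r)}$ of $\mathbf A$ with rank parameter $\mathbf r=(r_1,r_2,r_3)$ is robust in the relative norm: $$\|\mathbf A-\mathbf A^0_{(\mathbf r)}\|\le C'\,\|\mathbf A\|\sum_{\ell=1}^{3}\Big(\sum_{k=r_\ell+1}^{\min(n,R)}\sigma_{\ell,k}^2\Big)^{1/2},$$ where $\sigma_{\ell,k}$, $k\ge r_\ell+1$, are the truncated singular values of the side matrix $A^{(\ell)}$, and $C'$ is a constant depending only on $C$ (in particular not on $\mathbf A$, its decomposition, $n$, $R$ or $\mathbf r$).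
   Context: $\|\cdot\|$ is the Euclidean norm of vectors and the Frobenius norm of tensors. The side matrices are $A^{(\ell)}=[\mathbf a^{(\ell)}_1\ \dots\ \mathbf a^{(\ell)}_R]\in\mathbb R^{n\times R}$, $\ell=1,2,3$, with singular values $\sigma_{\ell,1}\ge\sigma_{\ell,2}\ge\dots\ge\sigma_{\ell,\min(n,R)}$ and SVD $A^{(\ell)}=Z^{(\ell)}D_\ell {V^{(\ell)}}^T=\sum_{k=1}^{\min(n,R)}\sigma_{\ell,k}\,\mathbf z^{(\ell)}_k{\mathbf v^{(\ell)}_k}^T$ with orthonormal $\mathbf z^{(\ell)}_k\in\mathbb R^n$ and orthonormal $\mathbf v^{(\ell)}_k\in\mathbb R^R$. Given $r_\ell<n$, $r_\ell\le\min(n,R)$, set $Z^{(\ell)}_0=[\mathbf z^{(\ell)}_1\ \dots\ \mathbf z^{(\ell)}_{r_\ell}]\in\mathbb R^{n\times r_\ell}$, the matrix of dominating left singular vectors. The reduced HOSVD (RHOSVD) approximation $\mathbf A^0_{(\mathbf r)}$ is the rank-$\mathbf r$ Tucker tensor obtained by orthogonally projecting $\mathbf A$ in each mode $\ell=1,2,3$ onto the column space of $Z^{(\ell)}_0$, i.e. $$\mathbf A^0_{(\mathbf r)}=\sum_{\nu=1}^{R}\xi_\nu\,\big(Z^{(1)}_0{Z^{(1)}_0}^T\mathbf a^{(1)}_\nu\big)\otimes\big(Z^{(2)}_0{Z^{(2)}_0}^T\mathbf a^{(2)}_\nu\big)\otimes\big(Z^{(3)}_0{Z^{(3)}_0}^T\mathbf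 a^{(3)}_\nu\big).$$ *)

theory Defs
  imports Complex_Main "Jordan_Normal_Form.Matrix"
begin

text \<open>
  Matrices and vectors come from Jordan_Normal_Form because the bound is uniform in the
  dimensions, which therefore have to be quantified inside the statement. Modes are numbered
  1, 2, 3. Entries, rank-one terms and singular values are numbered from 0, so the dominating
  singular values of a side matrix have indices below the rank parameter \<open>r\<close> and the truncated
  ones have the indices from \<open>r\<close> up to \<open>min n R - 1\<close>.
\<close>

definition euclid_norm :: "real vec \<Rightarrow> real" where
  "euclid_norm v = sqrt (v \<bullet> v)"

text \<open>
  A tensor of size \<open>n \<times> n \<times> n\<close> is represented by its entry function; only the entries with all
  three indices below \<open>n\<close> are meaningful.
\<close>

type_synonym tensor3 = "nat \<Rightarrow> nat \<Rightarrow> nat \<Rightarrow> real"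

definition tensor_norm :: "nat \<Rightarrow> tensor3 \<Rightarrow> real" where
  "tensor_norm n T = sqrt (\<Sum>i<n. \<Sum>j<n. \<Sum>k<n. (T i j k)\<^sup>2)"

definition tensor_diff :: "tensor3 \<Rightarrow> tensor3 \<Rightarrow> tensor3" where
  "tensor_diff S T = (\<lambda>i j k. S i j k - T i j k)"

definition outer3 :: "real vec \<Rightarrow> real vec \<Rightarrow> real vec \<Rightarrow> tensor3" where
  "outer3 u v w = (\<lambda>i j k. u $ i * v $ j * w $ k)"

text \<open>In the following, \<open>a l \<nu>\<close> is the \<open>\<nu>\<close>-th canonical vector of mode \<open>l\<close>.\<close>

definition canonical_tensor :: "nat \<Rightarrow> (nat \<Rightarrow> real) \<Rightarrow> (nat \<Rightarrow> nat \<Rightarrow> real vec) \<Rightarrow> tensor3" where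
  "canonical_tensor R \<xi> a = (\<lambda>i j k. \<Sum>\<nu><R. \<xi> \<nu> * outer3 (a 1 \<nu>) (a 2 \<nu>) (a 3 \<nu>) i j k)"

definition side_matrix :: "nat \<Rightarrow> nat \<Rightarrow> (nat \<Rightarrow> real vec) \<Rightarrow> real mat" where
  "side_matrix n R b = mat_of_cols n (map b [0..<R])"

text \<open>
  The reduced singular value decomposition \<open>A = Z D V\<^sup>T\<close> of an \<open>n \<times> R\<close> matrix, where \<open>D\<close> is square
  of size \<open>min n R\<close> with diagonal \<open>\<sigma>\<close>, and \<open>Z\<close> and \<open>V\<close> have orthonormal columns.
\<close>

definition is_svd ::
  "nat \<Rightarrow> nat \<Rightarrow> real mat \<Rightarrow> real mat \<Rightarrow> (nat \<Rightarrow> real) \<Rightarrow> real mat \<Rightarrow> bool" where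
  "is_svd n R A Z \<sigma> V \<longleftrightarrow>
     A \<in> carrier_mat n R \<and>
     Z \<in> carrier_mat n (min n R) \<and>
     V \<in> carrier_mat R (min n R) \<and>
     transpose_mat Z * Z = 1\<^sub>m (min n R) \<and>
     transpose_mat V * V = 1\<^sub>m (min n R) \<and>
     (\<forall>k < min n R. 0 \<le> \<sigma> k) \<and>
     (\<forall>j k. j \<le> k \<and> k < min n R \<longrightarrow> \<sigma> k \<le> \<sigma> j) \<and>
     A = Z * mat_diag (min n R) \<sigma> * transpose_mat V"

definition leading_cols :: "nat \<Rightarrow> real mat \<Rightarrow> real mat" where
  "leading_cols r Z = mat_of_cols (dim_row Z) (map (col Z) [0..<r])"

text \<open>
  The RHOSVD approximation is built from the matrices \<open>Z l\<close> of left singular vectors of the side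
  matrices, which are an argument because they need not be unique.
\<close>

definition rhosvd ::
  "nat \<Rightarrow> (nat \<Rightarrow> real) \<Rightarrow> (nat \<Rightarrow> nat \<Rightarrow> real vec) \<Rightarrow> (nat \<Rightarrow> real mat) \<Rightarrow> (nat \<Rightarrow> nat) \<Rightarrow> tensor3" where
  "rhosvd R \<xi> a Z r =
     canonical_tensor R \<xi>
       (\<lambda>l \<nu>. (leading_cols (r l) (Z l) * transpose_mat (leading_cols (r l) (Z l))) *\<^sub>v a l \<nu>)"

end

theory Submission
  imports Defs "HOL-Analysis.L2_Norm" "HOL-Analysis.Convex"
begin

text \<open>
  Projecting one mode of a canonical tensor at a time replaces the vectors \<open>a\<^sub>\<nu>\<close> of that mode by
  their projections \<open>p\<^sub>\<nu>\<close>, so the total error telescopes into three canonical tensors, each with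
  the residuals \<open>a\<^sub>\<nu> - p\<^sub>\<nu>\<close> in one mode and vectors of norm at most 1 in the other two. The
  Cauchy-Schwarz inequality in the summation index \<open>\<nu>\<close>, applied to each entry, bounds the norm of
  such a tensor by \<open>\<surd>(\<Sum>\<nu>. \<xi>\<^sub>\<nu>\<^sup>2) * \<surd>(\<Sum>\<nu>. \<parallel>a\<^sub>\<nu> - p\<^sub>\<nu>\<parallel>\<^sup>2)\<close>
  (lemma \<open>sum_canonical_entries_squared_le\<close>).

  The stability condition bounds the first factor by \<open>\<surd>C \<parallel>A\<parallel>\<close>. The second factor is the Frobenius
  norm of the side matrix minus its truncated singular value decomposition, and equals the
  square root of the sum of the squared truncated singular values
  (lemma \<open>svd_projection\<close>). Hence \<open>C' = \<surd>C\<close> works.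
\<close>

section \<open>Norms of canonical tensors\<close>

lemma tensor_norm_eq_L2_set:
  "tensor_norm n T = L2_set (\<lambda>(i, j, k). T i j k) ({..<n} \<times> {..<n} \<times> {..<n})"
  by (simp add: tensor_norm_def L2_set_def sum.cartesian_product case_prod_beta)

lemma tensor_norm_triangle:
  "tensor_norm n (\<lambda>i j k. S i j k + T i j k) \<le> tensor_norm n S + tensor_norm n T"
proof -
  have "(\<lambda>(i, j, k). S i j k + T i j k)
      = (\<lambda>x. (\<lambda>(i, j, k). S i j k) x + (\<lambda>(i, j, k). T i j k) x)"
    by auto
  then show ?thesis
    unfolding tensor_norm_eq_L2_set by (metis L2_set_triangle_ineq)
qed

text \<open>
  Cauchy-Schwarz in \<open>\<nu>\<close> is applied to each entry separately, which decouples the rank-one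
  terms. Summing over the entries afterwards factors the squared norm of each term over the modes.
\<close>

lemma sum_canonical_entries_squared_le:
  fixes \<xi> :: "nat \<Rightarrow> real" and u v w :: "nat \<Rightarrow> nat \<Rightarrow> real"
  shows "(\<Sum>i<n. \<Sum>j<n. \<Sum>k<n. (\<Sum>\<nu><R. \<xi> \<nu> * (u \<nu> i * v \<nu> j * w \<nu> k))\<^sup>2)
    \<le> (\<Sum>\<nu><R. (\<xi> \<nu>)\<^sup>2)
      * (\<Sum>\<nu><R. (\<Sum>i<n. (u \<nu> i)\<^sup>2) * (\<Sum>j<n. (v \<nu> j)\<^sup>2) * (\<Sum>k<n. (w \<nu> k)\<^sup>2))"
proof -
  have "(\<Sum>i<n. \<Sum>j<n. \<Sum>k<n. (\<Sum>\<nu><R. \<xi> \<nu> * (u \<nu> i * v \<nu> j * w \<nu> k))\<^sup>2)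
      \<le> (\<Sum>i<n. \<Sum>j<n. \<Sum>k<n. (\<Sum>\<nu><R. (\<xi> \<nu>)\<^sup>2) * (\<Sum>\<nu><R. (u \<nu> i * v \<nu> j * w \<nu> k)\<^sup>2))"
    by (intro sum_mono Cauchy_Schwarz_ineq_sum)
  also have "\<dots> = (\<Sum>\<nu><R. (\<xi> \<nu>)\<^sup>2)
      * (\<Sum>i<n. \<Sum>j<n. \<Sum>k<n. \<Sum>\<nu><R. (u \<nu> i * v \<nu> j * w \<nu> k)\<^sup>2)"
    by (simp add: sum_distrib_left)
  also have "(\<Sum>i<n. \<Sum>j<n. \<Sum>k<n. \<Sum>\<nu><R. (u \<nu> i * v \<nu> j * w \<nu> k)\<^sup>2)
      = (\<Sum>\<nu><R. \<Sum>i<n. \<Sum>j<n. \<Sum>k<n. (u \<nu> i * v \<nu> j * w \<nu> k)\<^sup>2)"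
    by (simp only: sum.swap[where B = "{..<R}"])
  also have "\<dots> = (\<Sum>\<nu><R. (\<Sum>i<n. (u \<nu> i)\<^sup>2) * (\<Sum>j<n. (v \<nu> j)\<^sup>2) * (\<Sum>k<n. (w \<nu> k)\<^sup>2))"
    by (simp only: power_mult_distrib flip: sum_distrib_left sum_distrib_right)
  finally show ?thesis .
qed

lemma tensor_norm_canonical_le:
  fixes \<xi> :: "nat \<Rightarrow> real" and u v w :: "nat \<Rightarrow> nat \<Rightarrow> real"
  assumes "(\<Sum>\<nu><R. (\<Sum>i<n. (u \<nu> i)\<^sup>2) * (\<Sum>j<n. (v \<nu> j)\<^sup>2) * (\<Sum>k<n. (w \<nu> k)\<^sup>2)) \<le> S"
  shows "tensor_norm n (\<lambda>i j k. \<Sum>\<nu><R. \<xi> \<nu> * (u \<nu> i * v \<nu> j * w \<nu> k))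
    \<le> sqrt (\<Sum>\<nu><R. (\<xi> \<nu>)\<^sup>2) * sqrt S"
proof -
  have "(\<Sum>i<n. \<Sum>j<n. \<Sum>k<n. (\<Sum>\<nu><R. \<xi> \<nu> * (u \<nu> i * v \<nu> j * w \<nu> k))\<^sup>2)
      \<le> (\<Sum>\<nu><R. (\<xi> \<nu>)\<^sup>2) * S"
    by (rule order_trans[OF sum_canonical_entries_squared_le mult_left_mono[OF assms]])
      (simp add: sum_nonneg)
  then show ?thesis
    unfolding tensor_norm_def real_sqrt_mult[symmetric] by (rule real_sqrt_le_mono)
qed

text \<open>
  Replacing \<open>x\<close> by \<open>y\<close> one mode at a time leaves a single difference \<open>x l \<nu> - y l \<nu>\<close> in
  each rank-one term. The other two factors have norm at most 1 and can be dropped from the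
  Cauchy-Schwarz bound.
\<close>

lemma tensor_norm_canonical_diff_le:
  fixes \<xi> :: "nat \<Rightarrow> real" and x y :: "nat \<Rightarrow> nat \<Rightarrow> nat \<Rightarrow> real"
  assumes x: "\<And>l \<nu>. l \<in> {1..3} \<Longrightarrow> \<nu> < R \<Longrightarrow> (\<Sum>i<n. (x l \<nu> i)\<^sup>2) \<le> 1"
    and y: "\<And>l \<nu>. l \<in> {1..3} \<Longrightarrow> \<nu> < R \<Longrightarrow> (\<Sum>i<n. (y l \<nu> i)\<^sup>2) \<le> 1"
  shows "tensor_norm n (\<lambda>i j k. (\<Sum>\<nu><R. \<xi> \<nu> * (x 1 \<nu> i * x 2 \<nu> j * x 3 \<nu> k))
        - (\<Sum>\<nu><R. \<xi> \<nu> * (y 1 \<nu> i * y 2 \<nu> j * y 3 \<nu> k)))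
    \<le> sqrt (\<Sum>\<nu><R. (\<xi> \<nu>)\<^sup>2)
      * (\<Sum>l\<in>{1..3}. sqrt (\<Sum>\<nu><R. \<Sum>i<n. (x l \<nu> i - y l \<nu> i)\<^sup>2))"
proof -
  let ?d = "\<lambda>l \<nu> i. x l \<nu> i - y l \<nu> i"
  let ?E = "\<lambda>l \<nu>. \<Sum>i<n. (?d l \<nu> i)\<^sup>2"
  define T1 where "T1 = (\<lambda>i j k. \<Sum>\<nu><R. \<xi> \<nu> * (?d 1 \<nu> i * x 2 \<nu> j * x 3 \<nu> k))"
  define T2 where "T2 = (\<lambda>i j k. \<Sum>\<nu><R. \<xi> \<nu> * (y 1 \<nu> i * ?d 2 \<nu> j * x 3 \<nu> k))"
  define T3 where "T3 = (\<lambda>i j k. \<Sum>\<nu><R. \<xi> \<nu> * (y 1 \<nu> i * y 2 \<nu> j * ?d 3 \<nu> k))"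
  have telescope: "(\<lambda>i j k. (\<Sum>\<nu><R. \<xi> \<nu> * (x 1 \<nu> i * x 2 \<nu> j * x 3 \<nu> k))
        - (\<Sum>\<nu><R. \<xi> \<nu> * (y 1 \<nu> i * y 2 \<nu> j * y 3 \<nu> k)))
      = (\<lambda>i j k. T1 i j k + (T2 i j k + T3 i j k))"
    unfolding T1_def T2_def T3_def sum_subtractf[symmetric] sum.distrib[symmetric]
    by (intro ext sum.cong refl) (simp add: algebra_simps)
  have drop_factors: "p * s * t \<le> p" "s * p * t \<le> p" "s * t * p \<le> p"
    if "0 \<le> p" "0 \<le> s" "s \<le> 1" "0 \<le> t" "t \<le> 1" for p s t :: real
  proof -
    have "p * (s * t) \<le> p * 1"
      using that by (intro mult_left_mono mult_le_one) auto
    then show "p * s * t \<le> p" "s * p * t \<le> p" "s * t * p \<le> p"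
      by (simp_all add: mult_ac)
  qed
  have "tensor_norm n T1 \<le> sqrt (\<Sum>\<nu><R. (\<xi> \<nu>)\<^sup>2) * sqrt (\<Sum>\<nu><R. ?E 1 \<nu>)"
    unfolding T1_def
    by (intro tensor_norm_canonical_le sum_mono drop_factors) (auto intro!: sum_nonneg x y)
  moreover have "tensor_norm n T2 \<le> sqrt (\<Sum>\<nu><R. (\<xi> \<nu>)\<^sup>2) * sqrt (\<Sum>\<nu><R. ?E 2 \<nu>)"
    unfolding T2_def
    by (intro tensor_norm_canonical_le sum_mono drop_factors) (auto intro!: sum_nonneg x y)
  moreover have "tensor_norm n T3 \<le> sqrt (\<Sum>\<nu><R. (\<xi> \<nu>)\<^sup>2) * sqrt (\<Sum>\<nu><R. ?E 3 \<nu>)"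
    unfolding T3_def
    by (intro tensor_norm_canonical_le sum_mono drop_factors) (auto intro!: sum_nonneg x y)
  moreover have "tensor_norm n (\<lambda>i j k. T1 i j k + (T2 i j k + T3 i j k))
      \<le> tensor_norm n T1 + (tensor_norm n T2 + tensor_norm n T3)"
    by (rule order_trans[OF tensor_norm_triangle add_left_mono[OF tensor_norm_triangle]])
  moreover have "{1..3::nat} = {1, 2, 3}"
    by auto
  ultimately show ?thesis
    unfolding telescope by (simp add: distrib_left)
qed

section \<open>Projection onto the dominating singular vectors\<close>

lemma transpose_mult_self_one_entries:
  fixes Z :: "real mat"
  assumes "Z \<in> carrier_mat n m" "transpose_mat Z * Z = 1\<^sub>m m" "k < m" "l < m"
  shows "(\<Sum>i<n. Z $$ (i, k) * Z $$ (i, l)) = (if k = l then 1 else 0)"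
proof -
  have "(transpose_mat Z * Z) $$ (k, l) = (\<Sum>i<n. Z $$ (i, k) * Z $$ (i, l))"
    using assms(1,3,4) by (simp add: scalar_prod_def lessThan_atLeast0)
  then show ?thesis
    using assms by simp
qed

lemma sum_orthonormal_combination_squared:
  fixes z :: "nat \<Rightarrow> 'k \<Rightarrow> real"
  assumes "finite K"
    and "\<And>k l. k \<in> K \<Longrightarrow> l \<in> K \<Longrightarrow> (\<Sum>i<n. z i k * z i l) = (if k = l then 1 else 0)"
  shows "(\<Sum>i<n. (\<Sum>k\<in>K. z i k * c k)\<^sup>2) = (\<Sum>k\<in>K. (c k)\<^sup>2)"
proof -
  have "(\<Sum>i<n. (\<Sum>k\<in>K. z i k * c k)\<^sup>2)
      = (\<Sum>i<n. \<Sum>k\<in>K. \<Sum>l\<in>K. c k * c l * (z i k * z i l))"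
    by (simp add: power2_eq_square sum_product mult_ac)
  also have "\<dots> = (\<Sum>k\<in>K. \<Sum>l\<in>K. c k * c l * (\<Sum>i<n. z i k * z i l))"
    by (simp add: sum.swap[where A = "{..<n}"] sum_distrib_left)
  also have "\<dots> = (\<Sum>k\<in>K. \<Sum>l\<in>K. if k = l then c k * c l else 0)"
    by (intro sum.cong refl) (simp add: assms(2))
  also have "\<dots> = (\<Sum>k\<in>K. (c k)\<^sup>2)"
    using assms(1) by (simp add: power2_eq_square)
  finally show ?thesis .
qed

lemma is_svd_entry:
  assumes "is_svd n R A Z \<sigma> V" "i < n" "\<nu> < R"
  shows "A $$ (i, \<nu>) = (\<Sum>k<min n R. Z $$ (i, k) * (\<sigma> k * V $$ (\<nu>, k)))"
proof -
  have Z: "Z \<in> carrier_mat n (min n R)" and V: "V \<in> carrier_mat R (min n R)"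
    and A: "A = Z * mat_diag (min n R) \<sigma> * transpose_mat V"
    using assms(1) by (auto simp: is_svd_def)
  show ?thesis
    unfolding A mat_diag_mult_right[OF Z]
    using Z V assms(2,3) by (simp add: scalar_prod_def lessThan_atLeast0 mult_ac)
qed

lemma projection_leading_cols_entry:
  assumes "Z \<in> carrier_mat n m" "r \<le> m" "v \<in> carrier_vec n" "i < n"
  shows "((leading_cols r Z * transpose_mat (leading_cols r Z)) *\<^sub>v v) $ i
    = (\<Sum>k<r. Z $$ (i, k) * (\<Sum>j<n. Z $$ (j, k) * v $ j))"
proof -
  have L: "leading_cols r Z \<in> carrier_mat n r"
    using assms(1) by (auto simp: leading_cols_def)
  have entry: "leading_cols r Z $$ (j, k) = Z $$ (j, k)" if "j < n" "k < r" for j k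
    using assms(1,2) that by (simp add: leading_cols_def mat_of_cols_index)
  have "(leading_cols r Z * transpose_mat (leading_cols r Z)) *\<^sub>v v
      = leading_cols r Z *\<^sub>v (transpose_mat (leading_cols r Z) *\<^sub>v v)"
    using L assms(3) by (intro assoc_mult_mat_vec) auto
  then show ?thesis
    using L assms(3,4) by (simp add: scalar_prod_def lessThan_atLeast0 entry)
qed

text \<open>
  In the basis of left singular vectors the \<open>\<nu>\<close>-th column of the matrix has the coefficients
  \<open>\<sigma> k * V $$ (\<nu>, k)\<close>, and the projection keeps those with \<open>k < r\<close>. The projection is
  therefore no longer than the column, and the squared residuals sum over all columns to the
  squared truncated singular values because the columns of \<open>V\<close> have norm 1.
\<close>

lemma svd_projection:
  fixes b :: "nat \<Rightarrow> real vec"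
  assumes svd: "is_svd n R (side_matrix n R b) Z \<sigma> V"
    and b: "\<And>\<nu>. \<nu> < R \<Longrightarrow> b \<nu> \<in> carrier_vec n" and r: "r \<le> min n R"
  defines "p \<equiv> \<lambda>\<nu>. (leading_cols r Z * transpose_mat (leading_cols r Z)) *\<^sub>v b \<nu>"
  shows svd_projection_norm_le:
      "\<nu> < R \<Longrightarrow> (\<Sum>i<n. (p \<nu> $ i)\<^sup>2) \<le> (\<Sum>i<n. (b \<nu> $ i)\<^sup>2)"
    and svd_projection_residual:
      "(\<Sum>\<nu><R. \<Sum>i<n. (b \<nu> $ i - p \<nu> $ i)\<^sup>2) = (\<Sum>k\<in>{r..<min n R}. (\<sigma> k)\<^sup>2)"
proof -
  let ?m = "min n R"
  define c where "c \<nu> k = \<sigma> k * V $$ (\<nu>, k)" for \<nu> k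
  have Z: "Z \<in> carrier_mat n ?m" "transpose_mat Z * Z = 1\<^sub>m ?m"
    and V: "V \<in> carrier_mat R ?m" "transpose_mat V * V = 1\<^sub>m ?m"
    using svd by (auto simp: is_svd_def)
  note orth = transpose_mult_self_one_entries[OF Z]
  have b_entry: "b \<nu> $ i = (\<Sum>k<?m. Z $$ (i, k) * c \<nu> k)" if "\<nu> < R" "i < n" for \<nu> i
    using is_svd_entry[OF svd that(2,1)] that
    by (simp add: side_matrix_def mat_of_cols_index c_def)
  have coeff: "(\<Sum>j<n. Z $$ (j, k) * b \<nu> $ j) = c \<nu> k" if "\<nu> < R" "k < ?m" for \<nu> k
  proof -
    have "(\<Sum>j<n. Z $$ (j, k) * b \<nu> $ j)
        = (\<Sum>j<n. \<Sum>l<?m. c \<nu> l * (Z $$ (j, k) * Z $$ (j, l)))"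
      using that(1) by (intro sum.cong refl) (simp add: b_entry sum_distrib_left mult_ac)
    also have "\<dots> = (\<Sum>l<?m. c \<nu> l * (\<Sum>j<n. Z $$ (j, k) * Z $$ (j, l)))"
      by (simp add: sum.swap[where A = "{..<n}"] sum_distrib_left)
    also have "\<dots> = (\<Sum>l<?m. if k = l then c \<nu> l else 0)"
      using that(2) by (intro sum.cong refl) (simp add: orth)
    also have "\<dots> = c \<nu> k"
      using that(2) by simp
    finally show ?thesis .
  qed
  have p_entry: "p \<nu> $ i = (\<Sum>k<r. Z $$ (i, k) * c \<nu> k)" if "\<nu> < R" "i < n" for \<nu> i
    unfolding p_def projection_leading_cols_entry[OF Z(1) r b[OF that(1)] that(2)]
    using that r by (intro sum.cong refl) (simp add: coeff)
  have split: "{..<?m} = {..<r} \<union> {r..<?m}"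
    using r by auto
  have residual_entry: "b \<nu> $ i - p \<nu> $ i = (\<Sum>k\<in>{r..<?m}. Z $$ (i, k) * c \<nu> k)"
    if "\<nu> < R" "i < n" for \<nu> i
    unfolding b_entry[OF that] p_entry[OF that] split by (subst sum.union_disjoint) auto
  have parseval: "(\<Sum>i<n. (\<Sum>k\<in>K. Z $$ (i, k) * c \<nu> k)\<^sup>2) = (\<Sum>k\<in>K. (c \<nu> k)\<^sup>2)"
    if "K \<subseteq> {..<?m}" for K \<nu>
    using that by (intro sum_orthonormal_combination_squared orth) (auto intro: finite_subset)
  show "(\<Sum>i<n. (p \<nu> $ i)\<^sup>2) \<le> (\<Sum>i<n. (b \<nu> $ i)\<^sup>2)" if "\<nu> < R"
  proof -
    have "(\<Sum>i<n. (p \<nu> $ i)\<^sup>2) = (\<Sum>k<r. (c \<nu> k)\<^sup>2)"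
      using that r by (simp add: p_entry parseval)
    also have "\<dots> \<le> (\<Sum>k<?m. (c \<nu> k)\<^sup>2)"
      using r by (intro sum_mono2) auto
    also have "\<dots> = (\<Sum>i<n. (b \<nu> $ i)\<^sup>2)"
      using that by (simp add: b_entry parseval)
    finally show ?thesis .
  qed
  have "(\<Sum>\<nu><R. \<Sum>i<n. (b \<nu> $ i - p \<nu> $ i)\<^sup>2) = (\<Sum>\<nu><R. \<Sum>k\<in>{r..<?m}. (c \<nu> k)\<^sup>2)"
    by (rule sum.cong) (simp_all add: residual_entry parseval subset_eq)
  also have "\<dots> = (\<Sum>k\<in>{r..<?m}. (\<sigma> k)\<^sup>2 * (\<Sum>\<nu><R. V $$ (\<nu>, k) * V $$ (\<nu>, k)))"
    by (simp add: sum.swap[where A = "{..<R}"] c_def power_mult_distrib sum_distrib_left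
        power2_eq_square[of "V $$ _"])
  also have "\<dots> = (\<Sum>k\<in>{r..<?m}. (\<sigma> k)\<^sup>2)"
    by (intro sum.cong refl) (simp add: transpose_mult_self_one_entries[OF V])
  finally show "(\<Sum>\<nu><R. \<Sum>i<n. (b \<nu> $ i - p \<nu> $ i)\<^sup>2) = (\<Sum>k\<in>{r..<?m}. (\<sigma> k)\<^sup>2)" .
qed

section \<open>Robustness of the reduced approximation\<close>

lemma euclid_norm_one_iff:
  assumes "v \<in> carrier_vec n"
  shows "euclid_norm v = 1 \<longleftrightarrow> (\<Sum>i<n. (v $ i)\<^sup>2) = 1"
  using assms by (simp add: euclid_norm_def scalar_prod_def lessThan_atLeast0 power2_eq_square)

text \<open>
  This is the absolute form of the bound; the stability condition enters only afterwards, to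
  exchange \<open>\<surd>(\<Sum>\<nu>. \<xi>\<^sub>\<nu>\<^sup>2)\<close> for the norm of the tensor.
\<close>

lemma rhosvd_error_le:
  assumes a: "\<And>l \<nu>. l \<in> {1..3} \<Longrightarrow> \<nu> < R \<Longrightarrow> a l \<nu> \<in> carrier_vec n"
    and unit: "\<And>l \<nu>. l \<in> {1..3} \<Longrightarrow> \<nu> < R \<Longrightarrow> euclid_norm (a l \<nu>) = 1"
    and svd: "\<And>l. l \<in> {1..3} \<Longrightarrow> is_svd n R (side_matrix n R (a l)) (Z l) (\<sigma> l) (V l)"
    and r: "\<And>l. l \<in> {1..3} \<Longrightarrow> r l \<le> min n R"
  shows "tensor_norm n (tensor_diff (canonical_tensor R \<xi> a) (rhosvd R \<xi> a Z r))
    \<le> sqrt (\<Sum>\<nu><R. (\<xi> \<nu>)\<^sup>2) * (\<Sum>l\<in>{1..3}. sqrt (\<Sum>k\<in>{r l..<min n R}. (\<sigma> l k)\<^sup>2))"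
proof -
  define p where
    "p l \<nu> = (leading_cols (r l) (Z l) * transpose_mat (leading_cols (r l) (Z l))) *\<^sub>v a l \<nu>"
    for l \<nu>
  have a_norm: "(\<Sum>i<n. (a l \<nu> $ i)\<^sup>2) = 1" if "l \<in> {1..3}" "\<nu> < R" for l \<nu>
    using unit[OF that] euclid_norm_one_iff[OF a[OF that]] by simp
  have p_norm: "(\<Sum>i<n. (p l \<nu> $ i)\<^sup>2) \<le> 1" if "l \<in> {1..3}" "\<nu> < R" for l \<nu>
    unfolding p_def a_norm[OF that, symmetric]
    using that by (intro svd_projection_norm_le[OF svd a r]) auto
  have residual: "(\<Sum>\<nu><R. \<Sum>i<n. (a l \<nu> $ i - p l \<nu> $ i)\<^sup>2)
      = (\<Sum>k\<in>{r l..<min n R}. (\<sigma> l k)\<^sup>2)" if "l \<in> {1..3}" for l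
    unfolding p_def using that by (intro svd_projection_residual[OF svd a r]) auto
  have "tensor_diff (canonical_tensor R \<xi> a) (rhosvd R \<xi> a Z r)
      = (\<lambda>i j k. (\<Sum>\<nu><R. \<xi> \<nu> * (a 1 \<nu> $ i * a 2 \<nu> $ j * a 3 \<nu> $ k))
        - (\<Sum>\<nu><R. \<xi> \<nu> * (p 1 \<nu> $ i * p 2 \<nu> $ j * p 3 \<nu> $ k)))"
    by (simp add: tensor_diff_def rhosvd_def canonical_tensor_def outer3_def p_def)
  moreover have "tensor_norm n \<dots> \<le> sqrt (\<Sum>\<nu><R. (\<xi> \<nu>)\<^sup>2)
      * (\<Sum>l\<in>{1..3}. sqrt (\<Sum>\<nu><R. \<Sum>i<n. (a l \<nu> $ i - p l \<nu> $ i)\<^sup>2))"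
    using a_norm p_norm
    by (intro tensor_norm_canonical_diff_le[where x = "\<lambda>l \<nu> i. a l \<nu> $ i"
          and y = "\<lambda>l \<nu> i. p l \<nu> $ i"]) auto
  ultimately show ?thesis
    using residual by simp
qed


theorem lemma4p2:
  fixes C :: real
  assumes "C > 0"
  shows "\<exists>C' :: real. C' > 0 \<and>
    (\<forall>(n :: nat) (R :: nat) (\<xi> :: nat \<Rightarrow> real) (a :: nat \<Rightarrow> nat \<Rightarrow> real vec)
      (Z :: nat \<Rightarrow> real mat) (\<sigma> :: nat \<Rightarrow> nat \<Rightarrow> real) (V :: nat \<Rightarrow> real mat) (r :: nat \<Rightarrow> nat).
      (\<forall>l\<in>{1..3}. \<forall>\<nu><R. a l \<nu> \<in> carrier_vec n \<and> euclid_norm (a l \<nu>) = 1) \<longrightarrow>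
      (\<forall>l\<in>{1..3}. is_svd n R (side_matrix n R (a l)) (Z l) (\<sigma> l) (V l)) \<longrightarrow>
      (\<forall>l\<in>{1..3}. r l < n \<and> r l \<le> min n R) \<longrightarrow>
      (\<Sum>\<nu><R. (\<xi> \<nu>)\<^sup>2) \<le> C * (tensor_norm n (canonical_tensor R \<xi> a))\<^sup>2 \<longrightarrow>
      tensor_norm n (tensor_diff (canonical_tensor R \<xi> a) (rhosvd R \<xi> a Z r))
        \<le> C' * tensor_norm n (canonical_tensor R \<xi> a)
             * (\<Sum>l\<in>{1..3}. sqrt (\<Sum>k\<in>{r l..<min n R}. (\<sigma> l k)\<^sup>2)))"
proof (intro exI[of _ "sqrt C"] conjI allI impI)
  show "sqrt C > 0"
    using assms by simp
next
  fix n R :: nat and \<xi> :: "nat \<Rightarrow> real" and a :: "nat \<Rightarrow> nat \<Rightarrow> real vec"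
    and Z :: "nat \<Rightarrow> real mat" and \<sigma> :: "nat \<Rightarrow> nat \<Rightarrow> real" and V :: "nat \<Rightarrow> real mat"
    and r :: "nat \<Rightarrow> nat"
  let ?A = "canonical_tensor R \<xi> a"
  let ?tail = "\<Sum>l\<in>{1..3}. sqrt (\<Sum>k\<in>{r l..<min n R}. (\<sigma> l k)\<^sup>2)"
  assume a: "\<forall>l\<in>{1..3}. \<forall>\<nu><R. a l \<nu> \<in> carrier_vec n \<and> euclid_norm (a l \<nu>) = 1"
    and svd: "\<forall>l\<in>{1..3}. is_svd n R (side_matrix n R (a l)) (Z l) (\<sigma> l) (V l)"
    and r: "\<forall>l\<in>{1..3}. r l < n \<and> r l \<le> min n R"
    and stable: "(\<Sum>\<nu><R. (\<xi> \<nu>)\<^sup>2) \<le> C * (tensor_norm n ?A)\<^sup>2"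
  have "0 \<le> tensor_norm n ?A"
    by (simp add: tensor_norm_def sum_nonneg)
  then have "sqrt (\<Sum>\<nu><R. (\<xi> \<nu>)\<^sup>2) \<le> sqrt C * tensor_norm n ?A"
    using real_sqrt_le_mono[OF stable] by (simp add: real_sqrt_mult)
  moreover have "0 \<le> ?tail"
    by (intro sum_nonneg) (simp add: sum_nonneg)
  moreover have "tensor_norm n (tensor_diff ?A (rhosvd R \<xi> a Z r))
      \<le> sqrt (\<Sum>\<nu><R. (\<xi> \<nu>)\<^sup>2) * ?tail"
    using a svd r by (intro rhosvd_error_le[where V = V]) auto
  ultimately show "tensor_norm n (tensor_diff ?A (rhosvd R \<xi> a Z r))
      \<le> sqrt C * tensor_norm n ?A * ?tail"
    by (meson mult_right_mono order_trans)
qed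

end
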